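(* Let $\mathbf{s}=(s_1,\dots,s_n)$ be a sequence of positive integers and $\mathbf{u}=(s_n,\dots,s_1)$ its reverse. For every $\mathbf{r}\in\Psi_n$, \[\operatorname{des}_{\mathbf{s}^*}(\mathbf{r},0)=\operatorname{des}_{\mathbf{u}^*}\big(\operatorname{reverse}(\Phi_{\mathbf{s}}(\mathbf{r})),0\big).\]
   Context: $\langle N\rangle=\{0,\dots,N\}$, $\Psi_n=\langle s_1-1\rangle\times\cdots\times\langle s_n-1\rangle$. $\mathbf{s}^*=(s_1,\dots,s_n,1)$, $\mathbf{u}^*=(s_n,\dots,s_1,1)$. $\operatorname{reverse}$ reverses a sequence. $\Phi_{\mathbf{s}}:\Psi_n\to\Psi_n$ sends $(r_1,\dots,r_n)$ to $(z_1,\dots,z_n)$ where $z_i\in\langle s_i-1\rangle$ and $r_i+z_i\equiv 0\pmod{s_i}$. For a sequence $\mathbf{t}=(t_1,\dots,t_m)$ of positive integers and $\mathbf{r}\in\mathbb{N}^m$, $\operatorname{des}_{\mathbf{t}}(\mathbf{r})=\#\{i\in\{1,\dots,m-1\}: r_i/t_i>r_{i+1}/t_{i+1}\}$; here $(\mathbf{r},0)$ denotes the sequence of length $n+1$ obtained by appending $0$. *)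

theory Defs
  imports Complex_Main "HOL-Number_Theory.Cong"
begin

text \<open>
  Sequences of length n are lists, indexed from 0: the entry called s_i in the mathematics
  is \<open>s ! (i - 1)\<close>.
\<close>

definition initial_seg :: "nat \<Rightarrow> nat set"  (\<open>\<langle>_\<rangle>\<close>)
  where "\<langle>N\<rangle> = {0..N}"

text \<open>The truncated subtraction is harmless, as the entries of \<open>s\<close> are positive.\<close>

definition Psi :: "nat list \<Rightarrow> nat list set"
  where "Psi s = {r. length r = length s \<and> (\<forall>i < length s. r ! i \<in> \<langle>s ! i - 1\<rangle>)}"

definition Phi :: "nat list \<Rightarrow> nat list \<Rightarrow> nat list"
  where "Phi s r = (THE z. z \<in> Psi s \<and> (\<forall>i < length s. [r ! i + z ! i = 0] (mod s ! i)))"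

text \<open>Meant for \<open>length r = length t\<close>; with indices from 0, \<open>Suc i < length t\<close> is the range 1..m-1.\<close>

definition des :: "nat list \<Rightarrow> nat list \<Rightarrow> nat"
  where "des t r = card {i. Suc i < length t \<and>
           real (r ! i) / real (t ! i) > real (r ! Suc i) / real (t ! Suc i)}"

text \<open>The description in \<open>Phi\<close> is proper:\<close>

lemma residue_ex1:
  fixes t x :: nat
  assumes "t > 0"
  shows "\<exists>!z. z \<in> \<langle>t - 1\<rangle> \<and> [x + z = 0] (mod t)"
proof -
  have "(x + (t - x mod t) mod t) mod t = (x mod t + (t - x mod t)) mod t"
    by (metis mod_add_left_eq mod_add_right_eq)
  also have "x mod t + (t - x mod t) = t"
    using assms by (simp add: less_imp_le)
  finally have ex: "[x + (t - x mod t) mod t = 0] (mod t)"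
    by (simp add: cong_def)
  have uniq: "z = z'" if "z < t" "z' < t" "[x + z = 0] (mod t)" "[x + z' = 0] (mod t)" for z z'
  proof -
    have "[x + z = x + z'] (mod t)"
      using that(3,4) by (metis cong_sym cong_trans)
    then have "[z = z'] (mod t)"
      by (simp add: cong_add_lcancel_nat)
    then show ?thesis using that(1,2) by (simp add: cong_def)
  qed
  have seg: "z \<in> \<langle>t - 1\<rangle> \<longleftrightarrow> z < t" for z
    using assms by (auto simp: initial_seg_def)
  show ?thesis
    unfolding seg using ex uniq mod_less_divisor[OF assms] by blast
qed

lemma Phi_ex1:
  assumes "\<forall>i < length s. s ! i > 0"
  shows "\<exists>!z. z \<in> Psi s \<and> (\<forall>i < length s. [r ! i + z ! i = 0] (mod s ! i))"
proof -
  define f where "f i = (THE z. z \<in> \<langle>s ! i - 1\<rangle> \<and> [r ! i + z = 0] (mod s ! i))" for i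
  have f: "f i \<in> \<langle>s ! i - 1\<rangle> \<and> [r ! i + f i = 0] (mod s ! i)" if "i < length s" for i
    unfolding f_def by (rule theI'[OF residue_ex1]) (use that assms in simp)
  show ?thesis
  proof (rule ex1I[of _ "map f [0..<length s]"])
    show "map f [0..<length s] \<in> Psi s \<and>
        (\<forall>i < length s. [r ! i + map f [0..<length s] ! i = 0] (mod s ! i))"
      using f by (simp add: Psi_def)
  next
    fix z
    assume z: "z \<in> Psi s \<and> (\<forall>i < length s. [r ! i + z ! i = 0] (mod s ! i))"
    show "z = map f [0..<length s]"
    proof (rule nth_equalityI)
      show "length z = length (map f [0..<length s])"
        using z by (simp add: Psi_def)
    next
      fix i assume "i < length z"
      then have i: "i < length s" using z by (simp add: Psi_def)
      then have "z ! i = f i"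
      proof -
        have "z ! i \<in> \<langle>s ! i - 1\<rangle> \<and> [r ! i + z ! i = 0] (mod s ! i)"
          using z i by (simp add: Psi_def)
        moreover have "s ! i > 0" using assms i by simp
        ultimately show ?thesis
          using f[OF i] residue_ex1[of "s ! i" "r ! i"] by (metis (no_types, lifting))
      qed
      then show "z ! i = map f [0..<length s] ! i" using i by simp
    qed
  qed
qed

end

theory Submission
  imports Defs
begin

text \<open>
  Put \<open>x\<^sub>i = r\<^sub>i / s\<^sub>i\<close>, a number in \<open>[0,1)\<close>. The map \<open>\<Phi>\<close> replaces each \<open>x\<close> by \<open>f x\<close>, where \<open>f 0 = 0\<close> and
  \<open>f x = 1 - x\<close> otherwise. Reversing the order compensates for the reversal of the inequality between
  two nonzero entries, so the descents at a pair \<open>x, y\<close> of neighbours differ only if exactly one of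
  them is \<open>0\<close>: \<open>[x > y] - [f y > f x] = [x > 0] - [y > 0]\<close>. These differences telescope, and the
  appended \<open>0\<close> contributes the two boundary terms.
\<close>

text \<open>The recursive form replaces counting over an index set, so that the comparison can run
  by induction on the list of quotients.\<close>

fun descents :: "'a::linorder list \<Rightarrow> nat" where
  "descents (x # y # xs) = of_bool (x > y) + descents (y # xs)"
| "descents _ = 0"

text \<open>Removing the head of a list removes the last entry of its reverse, so the induction also
  needs descents split off on the right.\<close>

lemma descents_append2:
  "descents (xs @ [x, y]) = descents (xs @ [x]) + of_bool (x > y)"
  by (induction xs rule: descents.induct) auto

lemma card_descents:
  "descents xs = card {i. Suc i < length xs \<and> xs ! i > xs ! Suc i}"
proof (induction xs rule: descents.induct)
  case (1 x y xs)
  let ?A = "\<lambda>xs. {i. Suc i < length xs \<and> xs ! i > xs ! Suc i}"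
  have "?A (x # y # xs) = (if x > y then {0} else {}) \<union> Suc ` ?A (y # xs)"
  proof (intro set_eqI)
    fix i show "i \<in> ?A (x # y # xs) \<longleftrightarrow> i \<in> (if x > y then {0} else {}) \<union> Suc ` ?A (y # xs)"
      by (cases i) auto
  qed
  also have "card \<dots> = of_bool (x > y) + card (?A (y # xs))"
    by (subst card_Un_disjoint) (auto simp: card_image)
  finally show ?case
    using 1 by simp
qed auto

lemma des_eq_descents:
  assumes "length r = length t"
  shows "des t r = descents (map2 (\<lambda>a b. real a / real b) r t)"
  unfolding des_def card_descents
  by (rule arg_cong[of _ _ card]) (use assms in auto)

definition reflect :: "real \<Rightarrow> real"
  where "reflect x = (if x = 0 then 0 else 1 - x)"

lemma descents_rev_reflect:
  assumes "\<forall>x \<in> set xs. 0 \<le> x \<and> x < 1"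
  shows "descents (xs @ [0]) = descents (rev (map reflect xs) @ [0])"
  using assms
proof (induction xs rule: induct_list012)
  case (2 x)
  then show ?case by (auto simp: reflect_def)
next
  case (3 x y xs)
  let ?R = "rev (map reflect xs)"
  have "descents ((x # y # xs) @ [0]) = of_bool (x > y) + descents ((y # xs) @ [0])"
    by simp
  also have "descents ((y # xs) @ [0]) = descents (?R @ [reflect y]) + of_bool (reflect y > 0)"
    using 3 descents_append2[of ?R "reflect y" 0] by simp
  \<comment> \<open>The telescoping identity, by cases on \<open>x = 0\<close> and
    \<open>y = 0\<close>. The bound by 1 makes \<open>reflect x > 0\<close> equivalent to
    \<open>x > 0\<close>, and likewise for \<open>y\<close>.\<close>
  also have "of_bool (x > y) + (descents (?R @ [reflect y]) + of_bool (reflect y > 0)) =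
      descents (?R @ [reflect y]) + of_bool (reflect y > reflect x) + of_bool (reflect x > 0)"
    using "3.prems" by (auto simp: reflect_def)
  also have "\<dots> = descents (rev (map reflect (x # y # xs)) @ [0])"
    using descents_append2[of "?R @ [reflect y]" "reflect x" 0]
      descents_append2[of ?R "reflect y" "reflect x"] by simp
  finally show ?case .
qed auto

text \<open>Both \<open>r ! i\<close> and \<open>Phi s r ! i\<close> lie below \<open>s ! i\<close>,
  so their sum, a multiple of \<open>s ! i\<close>, is 0 or \<open>s ! i\<close>: the two cases of
  \<open>reflect\<close>.\<close>

lemma divide_Phi:
  assumes pos: "\<forall>i < length s. s ! i > 0" and r: "r \<in> Psi s" and i: "i < length s"
  shows "real (Phi s r ! i) / real (s ! i) = reflect (real (r ! i) / real (s ! i))"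
proof -
  have "Phi s r \<in> Psi s \<and> (\<forall>i < length s. [r ! i + Phi s r ! i = 0] (mod s ! i))"
    unfolding Phi_def by (rule theI'[OF Phi_ex1[OF pos]])
  then have z: "Phi s r ! i < s ! i" and dvd: "s ! i dvd r ! i + Phi s r ! i"
    using pos i by (fastforce simp: Psi_def initial_seg_def cong_0_iff)+
  have lt: "r ! i < s ! i"
    using pos r i by (fastforce simp: Psi_def initial_seg_def)
  from dvd obtain k where k: "r ! i + Phi s r ! i = s ! i * k" ..
  have "s ! i * k < s ! i * 2"
    using k z lt by linarith
  then have "k = 0 \<or> k = 1"
    by auto
  then have "real (r ! i) + real (Phi s r ! i) = 0 \<or>
      real (r ! i) + real (Phi s r ! i) = real (s ! i)"
    using k by (metis of_nat_add mult_0_right mult_1_right of_nat_0)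
  then show ?thesis
  proof
    assume "real (r ! i) + real (Phi s r ! i) = 0"
    then show ?thesis by (simp add: reflect_def)
  next
    assume sum: "real (r ! i) + real (Phi s r ! i) = real (s ! i)"
    then have "real (Phi s r ! i) / real (s ! i) = 1 - real (r ! i) / real (s ! i)"
      using lt by (simp add: diff_divide_eq_iff divide_simps)
    \<comment> \<open>Since \<open>Phi s r ! i < s ! i\<close>, the sum forces \<open>r ! i\<close>
      to be nonzero.\<close>
    then show ?thesis using sum z lt by (auto simp: reflect_def)
  qed
qed

lemma length_Phi:
  assumes "\<forall>i < length s. s ! i > 0"
  shows "length (Phi s r) = length s"
  using theI'[OF Phi_ex1[OF assms, of r], folded Phi_def] by (simp add: Psi_def)

theorem theorem5p8:
  fixes s u r :: "nat list"
  assumes "\<forall>i < length s. s ! i > 0"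
    and "u = rev s"
    and "r \<in> Psi s"
  shows "des (s @ [1]) (r @ [0]) = des (u @ [1]) (rev (Phi s r) @ [0])"
proof -
  let ?q = "\<lambda>r. map2 (\<lambda>a b. real a / real b) r s"
  have len: "length r = length s" "length (Phi s r) = length s"
    using assms length_Phi by (auto simp: Psi_def)
  have "r ! i < s ! i" if "i < length s" for i
    using assms(1,3) that by (fastforce simp: Psi_def initial_seg_def)
  then have range: "\<forall>x \<in> set (?q r). 0 \<le> x \<and> x < 1"
    using len by (fastforce simp: set_zip)
  have "?q (Phi s r) = map reflect (?q r)"
    using assms len by (intro nth_equalityI) (auto simp: divide_Phi)
  then have "rev (map reflect (?q r)) = rev (?q (Phi s r))"
    by (rule arg_cong[OF sym])
  also have "\<dots> = map2 (\<lambda>a b. real a / real b) (rev (Phi s r)) u"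
    using len assms(2) by (simp add: zip_rev rev_map)
  \<comment> \<open>On both sides the appended entries give the quotient 0/1, which is the final 0
    in \<open>descents_rev_reflect\<close>.\<close>
  finally show ?thesis
    using descents_rev_reflect[OF range] len assms(2) by (simp add: des_eq_descents)
qed

end
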